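(* Let $R=\mathbb{K}[x_1,\ldots,x_n]$ be a polynomial ring over a field $\mathbb{K}$ of prime characteristic $p>0$, with fraction field $K$ and $\mathfrak{m}=(x_1,\ldots,x_n)$. Let $\mathfrak{a}_\bullet$ be a filtration of non-zero proper ideals of $R$ (i.e. $\mathfrak{a}_i$ is non-zero and proper for $i\ge 1$) and let $v$ be a monomial valuation of $K$ supported on $R$. If $\widehat{v}(\mathfrak{a}_\bullet)>0$, then $$\mathcal{C}^{\mathfrak{m}}(\mathfrak{a}_\bullet)\le\frac{v(x_1\cdots x_n)}{\widehat{v}(\mathfrak{a}_\bullet)}$$ (in particular $\mathcal{C}^{\mathfrak{m}}(\mathfrak{a}_\bullet)$ exists). Moreover, if $v(\mathfrak{m})>0$ and $\mathcal{C}^{\mathfrak{m}}(\mathfrak{a}_\bullet)$ exists, then $\widehat{v}(\mathfrak{a}_\bullet)>0$.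
   Context: A filtration of ideals in $R$ is a sequence $\mathfrak{a}_\bullet=\{\mathfrak{a}_i\}_{i\ge 0}$ of ideals with $\mathfrak{a}_0=R$, $\mathfrak{a}_{i+1}\subseteq\mathfrak{a}_i$, and $\mathfrak{a}_i\mathfrak{a}_j\subseteq \mathfrak{a}_{i+j}$ for all $i,j\ge 0$. Valuations are real-valued; $v$ is supported on $R$ if $v(f)\ge 0$ for all $f\in R\setminus\{0\}$; $v$ is monomial if $v(f)=\min\{v(u):u\text{ a monomial term of }f\}$ for all non-zero $f\in R$. For an ideal $J$, $v(J)=\min\{v(f):f\in J\setminus\{0\}\}$, and the skew Waldschmidt constant is $\widehat{v}(\mathfrak{a}_\bullet)=\lim_{r\to\infty}v(\mathfrak{a}_r)/r=\inf_{r\ge 1}v(\mathfrak{a}_r)/r$. $\mathfrak{m}^{[p^e]}=(x_1^{p^e},\ldots,x_n^{p^e})$, $\nu_{\mathfrak{a}_\bullet}^{\mathfrak{m}}(p^e)=\sup\{r\in\mathbb{Z}_{\ge 0}:\mathfrak{a}_r\not\subseteq\mathfrak{m}^{[p^e]}\}$, and $\mathcal{C}^{\mathfrak{m}}(\mathfrak{a}_\bullet)=\lim_{e\to\infty}\nu_{\mathfrak{a}_\bullet}^{\mathfrak{m}}(p^e)/p^e$, said to exist when the limit exists and is a finite real number. *)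

theory Defs
  imports
    "HOL-Analysis.Analysis"
    "HOL-Library.Poly_Mapping"
    "HOL-Library.Extended_Nat"
    "HOL-Computational_Algebra.Computational_Algebra"
begin

section \<open>Polynomial rings\<close>

text \<open>
  The polynomial ring \<open>R\<close> over \<open>'k\<close> in the finitely many variables indexed by \<open>'n\<close>. An element maps
  exponent vectors to coefficients, and multiplication is convolution. So \<open>n\<close> is \<open>CARD('n)\<close>. The linear
  order on \<open>'n\<close> demanded below is not used by any definition: the library requires it only
  to derive that \<open>R\<close> is an integral domain, so that its fraction field \<open>('n, 'k) mpoly fract\<close> can be formed.
\<close>

type_synonym ('n, 'k) mpoly = "('n \<Rightarrow>\<^sub>0 nat) \<Rightarrow>\<^sub>0 'k"

definition Var :: "'n \<Rightarrow> ('n, 'k::zero_neq_one) mpoly" where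
  "Var i = Poly_Mapping.single (Poly_Mapping.single i 1) 1"

section \<open>Ideals and filtrations\<close>

text \<open>An ideal of a commutative ring is a submodule of the ring as a module over itself.\<close>

global_interpretation ring_module: module "(*) :: 'a::comm_ring_1 \<Rightarrow> 'a \<Rightarrow> 'a"
  defines is_ideal = ring_module.subspace
    and ideal_gen = ring_module.span
  by unfold_locales (simp_all add: algebra_simps)

definition ideal_mult :: "'a::comm_ring_1 set \<Rightarrow> 'a set \<Rightarrow> 'a set" where
  "ideal_mult I J = ideal_gen {f * g | f g. f \<in> I \<and> g \<in> J}"

definition filtration :: "(nat \<Rightarrow> 'a::comm_ring_1 set) \<Rightarrow> bool" where
  "filtration a \<longleftrightarrow>
     (\<forall>i. is_ideal (a i)) \<and> a 0 = UNIV \<and> (\<forall>i. a (Suc i) \<subseteq> a i) \<and>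
     (\<forall>i j. ideal_mult (a i) (a j) \<subseteq> a (i + j))"

definition vars_ideal :: "('n, 'k::comm_ring_1) mpoly set" where
  "vars_ideal = ideal_gen (range Var)"

definition frob_power :: "nat \<Rightarrow> ('n, 'k::comm_ring_1) mpoly set" where
  "frob_power q = ideal_gen (range (\<lambda>i. Var i ^ q))"

section \<open>Valuations\<close>

text \<open>
  A real-valued valuation is defined on the non-zero elements of the field. Here it is a total
  function whose value at \<open>0\<close> is irrelevant and never used.
\<close>

definition valuation :: "('f::field \<Rightarrow> real) \<Rightarrow> bool" where
  "valuation v \<longleftrightarrow>
     (\<forall>f g. f \<noteq> 0 \<longrightarrow> g \<noteq> 0 \<longrightarrow> v (f * g) = v f + v g) \<and>
     (\<forall>f g. f \<noteq> 0 \<longrightarrow> g \<noteq> 0 \<longrightarrow> f + g \<noteq> 0 \<longrightarrow> min (v f) (v g) \<le> v (f + g))"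

definition supported_on_ring :: "('a::idom fract \<Rightarrow> real) \<Rightarrow> bool" where
  "supported_on_ring v \<longleftrightarrow> (\<forall>f. f \<noteq> 0 \<longrightarrow> 0 \<le> v (to_fract f))"

definition monomial_valuation ::
  "(('n::linorder, 'k::field) mpoly fract \<Rightarrow> real) \<Rightarrow> bool" where
  "monomial_valuation v \<longleftrightarrow> valuation v \<and>
     (\<forall>f. f \<noteq> 0 \<longrightarrow>
        v (to_fract f) =
          Min ((\<lambda>t. v (to_fract (Poly_Mapping.single t (Poly_Mapping.lookup f t))))
                 ` Poly_Mapping.keys f))"

text \<open>
  The minimum is attained for every non-zero ideal \<open>J\<close> when \<open>v\<close> is supported on the
  (Noetherian) ring: it is the least value on a finite generating set of \<open>J\<close>.
\<close>

definition ideal_val :: "('a::idom fract \<Rightarrow> real) \<Rightarrow> 'a set \<Rightarrow> real" where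
  "ideal_val v J = (LEAST r. \<exists>f \<in> J - {0}. r = v (to_fract f))"

text \<open>
  For a filtration of non-zero ideals and a supported valuation, the limit exists and equals the
  infimum over \<open>r \<ge> 1\<close>, because \<open>r \<mapsto> v (a r)\<close> is subadditive and non-negative (Fekete).
\<close>

definition skew_waldschmidt :: "('a::idom fract \<Rightarrow> real) \<Rightarrow> (nat \<Rightarrow> 'a set) \<Rightarrow> real" where
  "skew_waldschmidt v a = lim (\<lambda>r. ideal_val v (a r) / real r)"

section \<open>F-thresholds\<close>

text \<open>The supremum may be infinite, hence is taken in the extended natural numbers.\<close>

definition nu :: "(nat \<Rightarrow> ('n, 'k::comm_ring_1) mpoly set) \<Rightarrow> nat \<Rightarrow> enat" where
  "nu a q = Sup (enat ` {r. \<not> a r \<subseteq> frob_power q})"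

definition nu_ratio :: "nat \<Rightarrow> (nat \<Rightarrow> ('n, 'k::comm_ring_1) mpoly set) \<Rightarrow> nat \<Rightarrow> ereal" where
  "nu_ratio p a e = ereal_of_enat (nu a (p ^ e)) / ereal (real (p ^ e))"

definition F_threshold_exists :: "nat \<Rightarrow> (nat \<Rightarrow> ('n, 'k::comm_ring_1) mpoly set) \<Rightarrow> bool" where
  "F_threshold_exists p a \<longleftrightarrow> (\<exists>c::real. nu_ratio p a \<longlonglongrightarrow> ereal c)"

text \<open>Meaningful only under \<open>F_threshold_exists p a\<close>.\<close>

definition F_threshold :: "nat \<Rightarrow> (nat \<Rightarrow> ('n, 'k::comm_ring_1) mpoly set) \<Rightarrow> real" where
  "F_threshold p a = real_of_ereal (lim (nu_ratio p a))"

end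

theory Submission
  imports Defs
begin

text \<open>
  An element lies in \<open>(x\<^sub>1\<^sup>q, \<dots>, x\<^sub>n\<^sup>q)\<close> iff each of its monomials is divisible by some \<open>x\<^sub>i\<^sup>q\<close>, and the
  valuation of a monomial is the linear form with coefficients \<open>v(x\<^sub>i) \<ge> 0\<close> in its exponents. If
  \<open>a\<^sub>r\<close> is not contained in the Frobenius power, some element of \<open>a\<^sub>r\<close> has a monomial with all exponents
  below \<open>q\<close>, so \<open>r w \<le> v(a\<^sub>r) \<le> q v(x\<^sub>1 \<dots> x\<^sub>n)\<close>, where \<open>w\<close> is the skew Waldschmidt constant. This
  bounds \<open>\<nu>(q)/q\<close>, and \<open>\<nu>(p\<^sup>e)/p\<^sup>e\<close> is increasing in \<open>e\<close> because \<open>f \<mapsto> f\<^sup>p\<close> scales exponents by \<open>p\<close>.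
  Conversely, if \<open>\<nu>(q) \<le> C q\<close> for large \<open>q = p\<^sup>e\<close>, then \<open>a\<^sub>r\<close> lies in the Frobenius power for
  \<open>r = \<lfloor>C q\<rfloor> + 1\<close>, whence \<open>v(a\<^sub>r) \<ge> q v(\<mm>)\<close> and \<open>v(a\<^sub>r)/r \<ge> v(\<mm>)/(C + 1)\<close>.
\<close>

section \<open>Fekete's lemma\<close>

text \<open>Division with remainder by an index \<open>m\<close> whose ratio is nearly the infimum:
  the quotient part has ratio at most \<open>u m / m\<close>, and the remainder contributes a
  bounded amount that vanishes after division by \<open>n\<close>.\<close>

lemma fekete_nonneg:
  fixes u :: "nat \<Rightarrow> real"
  assumes sub: "\<And>m n. u (m + n) \<le> u m + u n" and nonneg: "\<And>n. 0 \<le> u n"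
  shows "(\<lambda>n. u n / real n) \<longlonglongrightarrow> (INF n\<in>{1..}. u n / real n)"
proof -
  define L where "L = (INF n\<in>{1..}. u n / real n)"
  have bdd: "bdd_below ((\<lambda>n. u n / real n) ` {1..})"
    using nonneg by (intro bdd_belowI[of _ 0]) auto
  have mult: "u (k * m + s) \<le> real k * u m + u s" for k m s
  proof (induction k)
    case (Suc k)
    have "u (Suc k * m + s) \<le> u m + u (k * m + s)"
      using sub[of m "k * m + s"] by (simp add: add.assoc)
    with Suc show ?case by (simp add: algebra_simps)
  qed simp
  have "\<exists>N. \<forall>n\<ge>N. \<bar>u n / real n - L\<bar> < e" if "e > 0" for e
  proof -
    have "L < L + e / 2" using that by simp
    then obtain m where m: "m \<ge> 1" "u m / real m < L + e / 2"
      unfolding L_def by (subst (asm) cINF_less_iff[OF _ bdd]) auto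
    \<comment> \<open>By nonnegativity, this sum dominates \<open>u s\<close> for every possible
      remainder \<open>s\<close>.\<close>
    define M where "M = (\<Sum>s<m. u s)"
    have M: "u s \<le> M" if "s < m" for s
      unfolding M_def using that nonneg by (intro member_le_sum) auto
    \<comment> \<open>Beyond this threshold the remainder costs less than \<open>e / 2\<close> per
      unit of \<open>n\<close>; the other \<open>e / 2\<close> comes from the choice of
      \<open>m\<close>.\<close>
    obtain N where N: "2 * M / e < real N" using reals_Archimedean2 by blast
    have "\<bar>u n / real n - L\<bar> < e" if n: "n \<ge> Suc N" for n
    proof -
      have "L \<le> u n / real n"
        unfolding L_def using n by (intro cINF_lower[OF bdd]) auto
      moreover have "u n / real n < L + e"
      proof -
        have "u n \<le> real (n div m) * u m + u (n mod m)"
          using mult[of "n div m" m "n mod m"] by simp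
        also have "u (n mod m) \<le> M" using m by (intro M) auto
        also have "real (n div m) * u m = real (n div m * m) * (u m / real m)"
          using m by simp
        also have "\<dots> \<le> real n * (u m / real m)"
          using nonneg by (intro mult_right_mono) (auto simp flip: of_nat_mult)
        finally have "u n \<le> real n * (u m / real m) + M" by simp
        moreover have "real n * (u m / real m) < real n * (L + e / 2)"
          using m n by (intro mult_strict_left_mono) auto
        moreover have "M < real n * (e / 2)"
        proof -
          have "2 * M / e < real n" using N n by linarith
          with \<open>e > 0\<close> show ?thesis by (simp add: field_simps)
        qed
        ultimately have "u n < real n * (L + e)" by (simp add: algebra_simps)
        with n show ?thesis by (simp add: field_simps)
      qed
      ultimately show ?thesis by linarith
    qed
    then show ?thesis by blast
  qed
  then show ?thesis unfolding LIMSEQ_iff L_def by simp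
qed

section \<open>Monomials and Frobenius powers\<close>

lemma sum_single_lookup:
  fixes f :: "'a \<Rightarrow>\<^sub>0 'b::comm_monoid_add"
  shows "(\<Sum>t\<in>Poly_Mapping.keys f. Poly_Mapping.single t (Poly_Mapping.lookup f t)) = f"
  by (rule poly_mapping_eqI)
     (auto simp: lookup_sum lookup_single when_def in_keys_iff)

lemma lookup_map_times [simp]:
  fixes t :: "'n \<Rightarrow>\<^sub>0 nat"
  shows "Poly_Mapping.lookup (Poly_Mapping.map ((*) m) t) i = m * Poly_Mapping.lookup t i"
  by (simp add: Poly_Mapping.map.rep_eq when_def)

lemma single_power:
  fixes c :: "'k::comm_semiring_1"
  shows "Poly_Mapping.single (t :: 'n \<Rightarrow>\<^sub>0 nat) c ^ m =
           Poly_Mapping.single (Poly_Mapping.map ((*) m) t) (c ^ m)"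
proof (induction m)
  case 0
  have zero: "Poly_Mapping.map ((*) 0) t = 0"
    by (rule poly_mapping_eqI) (simp only: lookup_map_times lookup_zero mult_0)
  show ?case by (simp only: zero power_0 single_one)
next
  case (Suc m)
  have "t + Poly_Mapping.map ((*) m) t = Poly_Mapping.map ((*) (Suc m)) t"
    by (rule poly_mapping_eqI) (simp only: lookup_map_times lookup_add mult_Suc)
  with Suc show ?case by (simp only: power_Suc mult_single)
qed

lemma Var_power: "Var i ^ q = Poly_Mapping.single (Poly_Mapping.single i q) (1 :: 'k::comm_semiring_1)"
  by (simp add: Var_def single_power)

lemma Var_neq_0 [simp]: "(Var i :: ('n, 'k::zero_neq_one) mpoly) \<noteq> 0"
  unfolding Var_def by (metis lookup_single_eq lookup_zero zero_neq_one)

lemma prod_Var_power: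
  fixes t :: "'n::finite \<Rightarrow>\<^sub>0 nat"
  shows "(\<Prod>i\<in>UNIV. Var i ^ Poly_Mapping.lookup t i) =
           (Poly_Mapping.single t 1 :: ('n, 'k::comm_semiring_1) mpoly)"
proof -
  have "(\<Prod>i\<in>A. Var i ^ Poly_Mapping.lookup t i) =
          (Poly_Mapping.single (\<Sum>i\<in>A. Poly_Mapping.single i (Poly_Mapping.lookup t i)) 1 :: ('n, 'k) mpoly)"
    if "finite A" for A
    using that by induction (auto simp: Var_power mult_single)
  moreover have "(\<Sum>i\<in>UNIV. Poly_Mapping.single i (Poly_Mapping.lookup t i)) = t"
    by (rule poly_mapping_eqI) (simp add: lookup_sum lookup_single when_def)
  ultimately show ?thesis by simp
qed

text \<open>The exponent condition cuts out an ideal that contains the generators; conversely each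
  term satisfying it is a multiple of some generator, and an element is the sum of its
  terms.\<close>

lemma frob_power_iff:
  fixes f :: "('n, 'k::comm_ring_1) mpoly"
  shows "f \<in> frob_power q \<longleftrightarrow>
           (\<forall>t\<in>Poly_Mapping.keys f. \<exists>i. q \<le> Poly_Mapping.lookup t i)"
proof
  define F where
    "F = {f :: ('n, 'k) mpoly. \<forall>t\<in>Poly_Mapping.keys f. \<exists>i. q \<le> Poly_Mapping.lookup t i}"
  have "is_ideal F"
    unfolding ring_module.subspace_def
  proof (intro conjI ballI allI)
    show "0 \<in> F" by (simp add: F_def)
    show "f + g \<in> F" if "f \<in> F" "g \<in> F" for f g
      using that Poly_Mapping.keys_add[of f g] unfolding F_def by blast
    show "c * f \<in> F" if "f \<in> F" for c f
      using that keys_mult[of c f] unfolding F_def by (fastforce simp: lookup_add intro: trans_le_add2)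
  qed
  moreover have "range (\<lambda>i. Var i ^ q) \<subseteq> F"
    by (auto simp: F_def Var_power intro: exI[where x = q] split: if_splits)
       (metis lookup_single_eq order_refl)
  ultimately have "frob_power q \<subseteq> F"
    unfolding frob_power_def by (intro ring_module.span_minimal)
  then show "f \<in> frob_power q \<Longrightarrow> \<forall>t\<in>Poly_Mapping.keys f. \<exists>i. q \<le> Poly_Mapping.lookup t i"
    unfolding F_def by blast
next
  assume f: "\<forall>t\<in>Poly_Mapping.keys f. \<exists>i. q \<le> Poly_Mapping.lookup t i"
  have "Poly_Mapping.single t c \<in> frob_power q"
    if "q \<le> Poly_Mapping.lookup t i" for t :: "'n \<Rightarrow>\<^sub>0 nat" and i and c :: 'k
  proof -
    \<comment> \<open>Subtraction of exponents is truncated at 0, so this needs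
      \<open>q \<le> Poly_Mapping.lookup t i\<close>.\<close>
    have "t - Poly_Mapping.single i q + Poly_Mapping.single i q = t"
      using that by (intro poly_mapping_eqI) (auto simp: lookup_add lookup_minus lookup_single when_def)
    then have "Poly_Mapping.single t c = Poly_Mapping.single (t - Poly_Mapping.single i q) c * Var i ^ q"
      by (simp add: Var_power mult_single)
    then show ?thesis
      unfolding frob_power_def
      by (metis ring_module.span_base ring_module.span_scale rangeI)
  qed
  then have "(\<Sum>t\<in>Poly_Mapping.keys f. Poly_Mapping.single t (Poly_Mapping.lookup f t)) \<in> frob_power q"
    using f unfolding frob_power_def by (intro ring_module.span_sum) blast
  then show "f \<in> frob_power q" by (simp add: sum_single_lookup)
qed

section \<open>The Frobenius map in characteristic \<open>p\<close>\<close>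

lemma CHAR_mpoly: "CHAR(('n, 'k::comm_ring_1) mpoly) = CHAR('k)"
proof (rule CHAR_eqI)
  show "of_nat CHAR('k) = (0 :: ('n, 'k) mpoly)"
    by (metis of_nat_CHAR single_of_nat single_zero)
  show "CHAR('k) dvd m" if "of_nat m = (0 :: ('n, 'k) mpoly)" for m
    using that by (metis lookup_single_eq lookup_zero of_nat_eq_0_iff_char_dvd single_of_nat)
qed

text \<open>By the freshman's dream, \<open>f ^ p\<close> is the sum of the \<open>p\<close>-th
  powers of the terms of \<open>f\<close>, so a monomial of \<open>f\<close> with all exponents
  below \<open>q\<close> yields one of \<open>f ^ p\<close> with all exponents below
  \<open>p * q\<close>.\<close>

lemma power_CHAR_notin_frob_power:
  fixes f :: "('n::{finite,linorder}, 'k::field) mpoly"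
  assumes p: "prime p" "CHAR('k) = p" and f: "f \<notin> frob_power q"
  shows "f ^ p \<notin> frob_power (p * q)"
proof -
  obtain s where s: "s \<in> Poly_Mapping.keys f" "\<And>i. Poly_Mapping.lookup s i < q"
    using f by (auto simp: frob_power_iff not_le)
  have p0: "p > 0" using p(1) prime_gt_0_nat by blast
  let ?m = "\<lambda>t. Poly_Mapping.map ((*) p) t :: 'n \<Rightarrow>\<^sub>0 nat"
  \<comment> \<open>Distinct monomials keep distinct \<open>p\<close>-th powers, so nothing can
    cancel against the term of \<open>s\<close>.\<close>
  have inj: "?m t = ?m t' \<longleftrightarrow> t = t'" for t t'
    using p0 by (auto simp: poly_mapping_eq_iff fun_eq_iff)
  have "f ^ p = (\<Sum>t\<in>Poly_Mapping.keys f. Poly_Mapping.single t (Poly_Mapping.lookup f t)) ^ p"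
    by (simp only: sum_single_lookup)
  also have "\<dots> = (\<Sum>t\<in>Poly_Mapping.keys f. Poly_Mapping.single (?m t) (Poly_Mapping.lookup f t ^ p))"
    using p by (simp add: freshmans_dream_sum CHAR_mpoly single_power)
  finally have "Poly_Mapping.lookup (f ^ p) (?m s) = Poly_Mapping.lookup f s ^ p"
    using s(1) by (simp add: lookup_sum lookup_single when_def inj)
  then have "?m s \<in> Poly_Mapping.keys (f ^ p)"
    using s(1) by (simp add: in_keys_iff)
  moreover have "\<not> p * q \<le> Poly_Mapping.lookup (?m s) i" for i
    using s(2)[of i] p0 by (simp add: not_le)
  ultimately show ?thesis unfolding frob_power_iff by blast
qed

section \<open>Monomial valuations\<close>

lemma valuation_one: "valuation v \<Longrightarrow> v 1 = 0"
  unfolding valuation_def by (metis add_cancel_right_right mult_1 one_neq_zero)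

lemma valuation_mult: "valuation v \<Longrightarrow> f \<noteq> 0 \<Longrightarrow> g \<noteq> 0 \<Longrightarrow> v (f * g) = v f + v g"
  unfolding valuation_def by blast

lemma valuation_power:
  assumes "valuation v" "f \<noteq> 0"
  shows "v (f ^ m) = real m * v f"
  using assms by (induction m) (auto simp: valuation_one valuation_mult algebra_simps)

lemma to_fract_power: "to_fract (f ^ m) = to_fract f ^ m"
  by (induction m) auto

lemma to_fract_prod: "to_fract (\<Prod>i\<in>A. f i) = (\<Prod>i\<in>A. to_fract (f i))"
  by (induction A rule: infinite_finite_induct) auto

lemma valuation_prod:
  assumes "valuation v" "finite A" "\<And>i. i \<in> A \<Longrightarrow> f i \<noteq> 0"
  shows "v (\<Prod>i\<in>A. f i) = (\<Sum>i\<in>A. v (f i))"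
  using assms(2,3)
  by (induction A) (auto simp: valuation_one[OF assms(1)] valuation_mult[OF assms(1)])

locale supported_monomial_valuation =
  fixes v :: "('n::{finite,linorder}, 'k::field) mpoly fract \<Rightarrow> real"
  assumes monomial: "monomial_valuation v" and supported: "supported_on_ring v"
begin

text \<open>This is the value of \<open>v\<close> on every term with exponent vector
  \<open>t\<close> and non-zero coefficient, see \<open>val_single\<close>.\<close>

definition weight :: "('n \<Rightarrow>\<^sub>0 nat) \<Rightarrow> real" where
  "weight t = (\<Sum>i\<in>UNIV. real (Poly_Mapping.lookup t i) * v (to_fract (Var i)))"

lemma valuation: "valuation v"
  using monomial unfolding monomial_valuation_def by blast

lemma nonneg: "f \<noteq> 0 \<Longrightarrow> 0 \<le> v (to_fract f)"
  using supported unfolding supported_on_ring_def by blast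

lemma val_Var_nonneg: "0 \<le> v (to_fract (Var i))"
  by (simp add: nonneg)

text \<open>The values of \<open>c\<close> and \<open>inverse c\<close> are both nonnegative and add
  up to the value of 1, which is 0.\<close>

lemma val_const:
  assumes "c \<noteq> 0"
  shows "v (to_fract (Poly_Mapping.single 0 c)) = 0"
proof -
  have ne: "Poly_Mapping.single 0 d \<noteq> (0 :: ('n, 'k) mpoly)" if "d \<noteq> 0" for d
    using that by (metis lookup_single_eq lookup_zero)
  have "v (to_fract (Poly_Mapping.single 0 c)) + v (to_fract (Poly_Mapping.single 0 (inverse c)))
          = v (to_fract (Poly_Mapping.single 0 c * Poly_Mapping.single 0 (inverse c)))"
    using assms ne by (simp add: valuation_mult[OF valuation])
  also have "\<dots> = 0"
    using assms by (simp add: mult_single valuation_one[OF valuation])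
  finally show ?thesis
    using nonneg[OF ne[of c]] nonneg[OF ne[of "inverse c"]] assms by simp
qed

lemma val_single:
  assumes "c \<noteq> 0"
  shows "v (to_fract (Poly_Mapping.single t c)) = weight t"
proof -
  have "Poly_Mapping.single t c = Poly_Mapping.single 0 c * (\<Prod>i\<in>UNIV. Var i ^ Poly_Mapping.lookup t i)"
    by (simp add: prod_Var_power mult_single)
  moreover have "Poly_Mapping.single 0 c \<noteq> (0 :: ('n, 'k) mpoly)"
    using assms by (metis lookup_single_eq lookup_zero)
  ultimately show ?thesis
    using assms
    by (simp add: valuation_mult[OF valuation] val_const to_fract_prod to_fract_power
        valuation_prod[OF valuation] valuation_power[OF valuation] weight_def)
qed

lemma val_eq: "f \<noteq> 0 \<Longrightarrow> v (to_fract f) = Min (weight ` Poly_Mapping.keys f)"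
proof -
  assume "f \<noteq> 0"
  then have "v (to_fract f) = Min ((\<lambda>t. v (to_fract (Poly_Mapping.single t (Poly_Mapping.lookup f t))))
               ` Poly_Mapping.keys f)"
    using monomial unfolding monomial_valuation_def by blast
  also have "(\<lambda>t. v (to_fract (Poly_Mapping.single t (Poly_Mapping.lookup f t)))) ` Poly_Mapping.keys f
               = weight ` Poly_Mapping.keys f"
    by (intro image_cong) (auto simp: val_single in_keys_iff)
  finally show ?thesis .
qed

lemma val_le_weight: "t \<in> Poly_Mapping.keys f \<Longrightarrow> v (to_fract f) \<le> weight t"
  using val_eq[of f] by fastforce

lemma val_in_weights:
  assumes "f \<noteq> 0"
  shows "\<exists>t\<in>Poly_Mapping.keys f. v (to_fract f) = weight t"
proof -
  have "Poly_Mapping.keys f \<noteq> {}" using assms by simp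
  then have "Min (weight ` Poly_Mapping.keys f) \<in> weight ` Poly_Mapping.keys f"
    by (intro Min_in) auto
  with val_eq[OF assms] show ?thesis by auto
qed

lemma val_prod_Var: "v (to_fract (\<Prod>i\<in>UNIV. Var i)) = (\<Sum>i\<in>UNIV. v (to_fract (Var i)))"
  by (simp add: to_fract_prod valuation_prod[OF valuation])

text \<open>Variables of value 0 do not affect the weight, and the bound \<open>B\<close> limits the
  exponents of all others. This finiteness is what makes the minimum over an ideal exist.\<close>

lemma finite_weights_le: "finite {x \<in> range weight. x \<le> B}"
proof -
  define I where "I = {i. v (to_fract (Var i :: ('n, 'k) mpoly)) > 0}"
  define h where "h g = (\<Sum>i\<in>I. real (g i) * v (to_fract (Var i)))" for g :: "'n \<Rightarrow> nat"
  have "\<exists>N. \<forall>i\<in>I. B / v (to_fract (Var i)) \<le> real N"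
  proof -
    obtain N where "Max ((\<lambda>i. B / v (to_fract (Var i))) ` UNIV) \<le> real N"
      using real_arch_simple by blast
    then show ?thesis by (subst (asm) Max_le_iff) auto
  qed
  then obtain N where N: "\<And>i. i \<in> I \<Longrightarrow> B / v (to_fract (Var i)) \<le> real N" by blast
  \<comment> \<open>Restricting exponent vectors to \<open>I\<close> discards the exponents that
    stay unbounded and leaves finitely many candidates.\<close>
  have "{x \<in> range weight. x \<le> B} \<subseteq> h ` (PiE I (\<lambda>_. {..N}))"
  proof clarify
    fix t assume t: "weight t \<le> B"
    have "weight t = (\<Sum>i\<in>I. real (Poly_Mapping.lookup t i) * v (to_fract (Var i)))"
      unfolding weight_def
      by (rule sum.mono_neutral_right) (use val_Var_nonneg in \<open>auto simp: I_def not_less intro: antisym\<close>)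
    then have "weight t = h (restrict (Poly_Mapping.lookup t) I)" by (simp add: h_def)
    moreover have "Poly_Mapping.lookup t i \<le> N" if i: "i \<in> I" for i
    proof -
      have "real (Poly_Mapping.lookup t i) * v (to_fract (Var i)) \<le> weight t"
        unfolding weight_def
        by (rule member_le_sum[where f = "\<lambda>i. real (Poly_Mapping.lookup t i) * v (to_fract (Var i))"])
           (auto simp: val_Var_nonneg)
      then have "real (Poly_Mapping.lookup t i) \<le> B / v (to_fract (Var i))"
        using t i by (simp add: I_def pos_le_divide_eq)
      then show ?thesis using N[OF i] by linarith
    qed
    ultimately show "weight t \<in> h ` (PiE I (\<lambda>_. {..N}))" by (intro image_eqI) auto
  qed
  then show ?thesis by (rule finite_subset) (intro finite_imageI finite_PiE; simp)
qed

text \<open>\<open>LEAST\<close> over the reals has meaning only once a minimum is exhibited. Below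
  the value of any fixed non-zero element of \<open>J\<close> only finitely many values occur, so
  one is smallest.\<close>

lemma ideal_val_minimum:
  assumes "\<exists>f\<in>J. f \<noteq> 0"
  shows "\<exists>f\<in>J - {0}. ideal_val v J = v (to_fract f) \<and> (\<forall>g\<in>J - {0}. v (to_fract f) \<le> v (to_fract g))"
proof -
  obtain f0 where f0: "f0 \<in> J" "f0 \<noteq> 0" using assms by blast
  define S where "S = (\<lambda>f. v (to_fract f)) ` {f \<in> J - {0}. v (to_fract f) \<le> v (to_fract f0)}"
  have "S \<subseteq> {x \<in> range weight. x \<le> v (to_fract f0)}"
    using val_in_weights by (fastforce simp: S_def)
  then have fin: "finite S" using finite_weights_le finite_subset by blast
  have "S \<noteq> {}" using f0 by (auto simp: S_def)
  then have "Min S \<in> S" using fin by simp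
  then obtain f where f: "f \<in> J - {0}" "v (to_fract f) \<le> v (to_fract f0)" "Min S = v (to_fract f)"
    by (auto simp: S_def)
  have min: "v (to_fract f) \<le> v (to_fract g)" if "g \<in> J - {0}" for g
  proof (cases "v (to_fract g) \<le> v (to_fract f0)")
    case True
    then have "v (to_fract g) \<in> S" using that by (auto simp: S_def)
    then show ?thesis using fin f(3) Min_le by metis
  qed (use f(2) in linarith)
  have "ideal_val v J = v (to_fract f)"
    unfolding ideal_val_def by (rule Least_equality) (use f min in auto)
  with f min show ?thesis by blast
qed

lemma ideal_val_le: "f \<in> J \<Longrightarrow> f \<noteq> 0 \<Longrightarrow> ideal_val v J \<le> v (to_fract f)"
  using ideal_val_minimum[of J] by fastforce

lemma ideal_val_attained: "\<exists>f\<in>J. f \<noteq> 0 \<Longrightarrow> \<exists>f\<in>J. f \<noteq> 0 \<and> ideal_val v J = v (to_fract f)"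
  using ideal_val_minimum[of J] by blast

text \<open>Some monomial of \<open>f\<close> has all exponents below \<open>q\<close>, and its
  weight bounds the value of \<open>f\<close> from above.\<close>

lemma val_le_if_notin_frob_power:
  assumes "f \<notin> frob_power q"
  shows "v (to_fract f) \<le> real q * v (to_fract (\<Prod>i\<in>UNIV. Var i))"
proof -
  obtain t where t: "t \<in> Poly_Mapping.keys f" "\<And>i. Poly_Mapping.lookup t i < q"
    using assms by (auto simp: frob_power_iff not_le)
  have "v (to_fract f) \<le> weight t" using t(1) by (rule val_le_weight)
  also have "\<dots> \<le> (\<Sum>i\<in>UNIV. real q * v (to_fract (Var i)))"
    unfolding weight_def using t(2)
    by (intro sum_mono mult_right_mono val_Var_nonneg) (simp add: less_imp_le)
  finally show ?thesis by (simp add: val_prod_Var sum_distrib_left)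
qed

text \<open>The monomial that attains the value of \<open>f\<close> is divisible by some
  \<open>Var i ^ q\<close>; the other factors have nonnegative value.\<close>

lemma val_ge_if_in_frob_power:
  assumes "f \<in> frob_power q" "f \<noteq> 0"
  shows "real q * ideal_val v vars_ideal \<le> v (to_fract f)"
proof -
  obtain t where t: "t \<in> Poly_Mapping.keys f" "v (to_fract f) = weight t"
    using val_in_weights[OF assms(2)] by blast
  then obtain i where i: "q \<le> Poly_Mapping.lookup t i"
    using assms(1) by (auto simp: frob_power_iff)
  have "Var i \<in> vars_ideal"
    unfolding vars_ideal_def by (intro ring_module.span_base) simp
  then have "ideal_val v vars_ideal \<le> v (to_fract (Var i))"
    by (intro ideal_val_le) auto
  then have "real q * ideal_val v vars_ideal \<le> real q * v (to_fract (Var i))"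
    by (intro mult_left_mono) auto
  also have "\<dots> \<le> real (Poly_Mapping.lookup t i) * v (to_fract (Var i))"
    using i by (intro mult_right_mono val_Var_nonneg) simp
  also have "\<dots> \<le> weight t"
    unfolding weight_def
    by (rule member_le_sum[where f = "\<lambda>i. real (Poly_Mapping.lookup t i) * v (to_fract (Var i))"])
       (auto simp: val_Var_nonneg)
  finally show ?thesis by (simp add: t(2))
qed

end

section \<open>Filtrations\<close>

lemma filtration_mult:
  assumes "filtration a" "f \<in> a i" "g \<in> a j"
  shows "f * g \<in> a (i + j)"
proof -
  have "f * g \<in> ideal_mult (a i) (a j)"
    unfolding ideal_mult_def using assms(2,3) by (intro ring_module.span_base) blast
  with assms(1) show ?thesis unfolding filtration_def by blast
qed

lemma filtration_power:
  assumes "filtration a" "f \<in> a i"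
  shows "f ^ m \<in> a (m * i)"
proof (induction m)
  case 0
  then show ?case using assms(1) by (simp add: filtration_def)
qed (use filtration_mult[OF assms] in simp)

text \<open>The product of minimizers for \<open>a m\<close> and \<open>a n\<close> lies in
  \<open>a (m + n)\<close>, so the values are subadditive and Fekete's lemma identifies the limit
  with the infimum.\<close>

lemma skew_waldschmidt_limit:
  fixes a :: "nat \<Rightarrow> ('n::{finite,linorder}, 'k::field) mpoly set"
  assumes v: "monomial_valuation v" "supported_on_ring v" and a: "filtration a"
    and nz: "\<And>i. \<exists>f\<in>a i. f \<noteq> 0"
  shows "(\<lambda>r. ideal_val v (a r) / real r) \<longlonglongrightarrow> skew_waldschmidt v a"
    and "r \<ge> 1 \<Longrightarrow> skew_waldschmidt v a \<le> ideal_val v (a r) / real r"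
proof -
  interpret supported_monomial_valuation v using v by unfold_locales
  have nonneg': "0 \<le> ideal_val v (a r)" for r
    using ideal_val_attained[OF nz[of r]] nonneg by auto
  have "ideal_val v (a (m + n)) \<le> ideal_val v (a m) + ideal_val v (a n)" for m n
  proof -
    obtain f g where "f \<in> a m" "f \<noteq> 0" "ideal_val v (a m) = v (to_fract f)"
      and "g \<in> a n" "g \<noteq> 0" "ideal_val v (a n) = v (to_fract g)"
      using ideal_val_attained[OF nz] by metis
    then show ?thesis
      using ideal_val_le[OF filtration_mult[OF a, of f m g n]]
      by (simp add: valuation_mult[OF valuation])
  qed
  from fekete_nonneg[of "\<lambda>r. ideal_val v (a r)", OF this nonneg']
  have lim: "(\<lambda>r. ideal_val v (a r) / real r) \<longlonglongrightarrow> (INF r\<in>{1..}. ideal_val v (a r) / real r)" .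
  then have eq: "skew_waldschmidt v a = (INF r\<in>{1..}. ideal_val v (a r) / real r)"
    unfolding skew_waldschmidt_def by (rule limI)
  show "(\<lambda>r. ideal_val v (a r) / real r) \<longlonglongrightarrow> skew_waldschmidt v a"
    using lim eq by simp
  show "skew_waldschmidt v a \<le> ideal_val v (a r) / real r" if "r \<ge> 1"
    unfolding eq using that nonneg' by (intro cINF_lower bdd_belowI[of _ 0]) auto
qed

text \<open>Unfolds the extended supremum into a condition on single indices \<open>r\<close>, so
  that later estimates are made in the reals.\<close>

lemma nu_ratio_le_iff:
  assumes "filtration a" "p > 0"
  shows "nu_ratio p a e \<le> B \<longleftrightarrow>
           (\<forall>r. \<not> a r \<subseteq> frob_power (p ^ e) \<longrightarrow> ereal (real r / real (p ^ e)) \<le> B)"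
proof -
  let ?q = "p ^ e"
  have q: "ereal (real ?q) > 0" "ereal (real ?q) \<noteq> \<infinity>" using assms(2) by auto
  \<comment> \<open>The constant monomial has exponents 0, below \<open>?q\<close>. Hence
    \<open>r = 0\<close> always belongs to the set whose supremum is taken, and that set is
    non-empty.\<close>
  have "1 \<notin> frob_power ?q"
    using assms(2) by (auto simp: frob_power_iff)
  then have ne: "{r. \<not> a r \<subseteq> frob_power ?q} \<noteq> {}"
    using assms(1) unfolding filtration_def by (auto intro!: exI[where x = 0])
  have "nu_ratio p a e \<le> B \<longleftrightarrow> ereal_of_enat (nu a ?q) \<le> ereal (real ?q) * B"
    unfolding nu_ratio_def by (rule ereal_divide_le_pos[OF q])
  also have "\<dots> \<longleftrightarrow> (\<forall>r. \<not> a r \<subseteq> frob_power ?q \<longrightarrow> ereal (real r) \<le> ereal (real ?q) * B)"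
    unfolding nu_def using ne by (subst ereal_of_enat_Sup) (auto simp: SUP_le_iff)
  also have "\<dots> \<longleftrightarrow> (\<forall>r. \<not> a r \<subseteq> frob_power ?q \<longrightarrow> ereal (real r) / ereal (real ?q) \<le> B)"
    by (simp only: ereal_divide_le_pos[OF q])
  finally show ?thesis using assms(2) by simp
qed

text \<open>An index \<open>r\<close> at level \<open>e\<close> gives the index \<open>p * r\<close>
  at level \<open>Suc e\<close>, by raising an element to the power \<open>p\<close>; the ratio is
  unchanged.\<close>

lemma incseq_nu_ratio:
  fixes a :: "nat \<Rightarrow> ('n::{finite,linorder}, 'k::field) mpoly set"
  assumes p: "prime p" "CHAR('k) = p" and a: "filtration a"
  shows "incseq (nu_ratio p a)"
proof (rule incseq_SucI)
  fix e
  have p0: "p > 0" using p(1) prime_gt_0_nat by blast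
  have "ereal (real r / real (p ^ e)) \<le> nu_ratio p a (Suc e)"
    if r: "\<not> a r \<subseteq> frob_power (p ^ e)" for r
  proof -
    obtain f where f: "f \<in> a r" "f \<notin> frob_power (p ^ e)" using r by blast
    then have "\<not> a (p * r) \<subseteq> frob_power (p ^ Suc e)"
      using filtration_power[OF a f(1), of p] power_CHAR_notin_frob_power[OF p f(2)] by auto
    \<comment> \<open>With \<open>B\<close> equal to the ratio itself, the criterion says that the
      supremum is an upper bound.\<close>
    then have "ereal (real (p * r) / real (p ^ Suc e)) \<le> nu_ratio p a (Suc e)"
      using nu_ratio_le_iff[OF a p0, of "Suc e" "nu_ratio p a (Suc e)"] by blast
    then show ?thesis using p0 by simp
  qed
  then show "nu_ratio p a e \<le> nu_ratio p a (Suc e)"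
    using nu_ratio_le_iff[OF a p0] by blast
qed

section \<open>Finite F-thresholds and positive skew Waldschmidt constants\<close>

theorem theorem6p1:
  fixes p :: nat
    and a :: "nat \<Rightarrow> ('n::{finite,linorder}, 'k::field) mpoly set"
    and v :: "('n, 'k) mpoly fract \<Rightarrow> real"
  assumes "prime p" and "CHAR('k) = p"
    and "filtration a"
    and "\<And>i. i \<ge> 1 \<Longrightarrow> a i \<noteq> {0} \<and> a i \<noteq> UNIV"
    and "monomial_valuation v" and "supported_on_ring v"
  shows "(skew_waldschmidt v a > 0 \<longrightarrow>
            F_threshold_exists p a \<and>
            F_threshold p a \<le> v (to_fract (\<Prod>i\<in>UNIV. Var i)) / skew_waldschmidt v a) \<and>
         (ideal_val v vars_ideal > 0 \<and> F_threshold_exists p a \<longrightarrow> skew_waldschmidt v a > 0)"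
proof (intro conjI impI)
  interpret supported_monomial_valuation v using assms(5,6) by unfold_locales
  let ?w = "skew_waldschmidt v a"
  have p0: "p > 0" "p > 1" using assms(1) prime_gt_0_nat prime_gt_1_nat by blast+
  have nz: "\<exists>f\<in>a i. f \<noteq> 0" for i
  proof (cases "i = 0")
    case True
    then show ?thesis using assms(3) by (auto simp: filtration_def intro: exI[where x = 1])
  next
    case False
    have "0 \<in> a i"
      using assms(3) by (auto simp: filtration_def ring_module.subspace_def)
    then show ?thesis using assms(4)[of i] False by force
  qed
  note lim = skew_waldschmidt_limit[OF assms(5,6,3) nz]
  {
    assume w: "?w > 0"
    let ?B = "v (to_fract (\<Prod>i\<in>UNIV. Var i)) / ?w"
    have "real r / real (p ^ e) \<le> ?B"
      if r: "\<not> a r \<subseteq> frob_power (p ^ e)" for r e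
    \<comment> \<open>The comparison of the limit with \<open>ideal_val v (a r) / real r\<close>
      holds for \<open>r \<ge> 1\<close> only.\<close>
    proof (cases "r = 0")
      case True
      then show ?thesis using w by (simp add: nonneg)
    next
      case False
      obtain f where f: "f \<in> a r" "f \<notin> frob_power (p ^ e)" using r by blast
      then have "f \<noteq> 0" by (auto simp: frob_power_iff)
      have "real r * ?w \<le> ideal_val v (a r)"
        using lim(2)[of r] False by (simp add: field_simps)
      also have "\<dots> \<le> v (to_fract f)" using f(1) \<open>f \<noteq> 0\<close> by (rule ideal_val_le)
      also have "\<dots> \<le> real (p ^ e) * v (to_fract (\<Prod>i\<in>UNIV. Var i))"
        using f(2) by (rule val_le_if_notin_frob_power)
      finally show ?thesis using w p0 by (simp add: field_simps)
    qed
    then have le: "nu_ratio p a e \<le> ereal ?B" for e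
      using nu_ratio_le_iff[OF assms(3) p0(1)] by (metis ereal_less_eq(3))
    have ge: "0 \<le> nu_ratio p a e" for e
      using p0 unfolding nu_ratio_def by (simp add: zero_le_divide_ereal)
    define s where "s = (SUP e. nu_ratio p a e)"
    have conv: "nu_ratio p a \<longlonglongrightarrow> s"
      unfolding s_def by (rule LIMSEQ_SUP[OF incseq_nu_ratio[OF assms(1,2,3)]])
    \<comment> \<open>Monotone convergence takes place in the extended reals; these bounds make the
      limit a real number.\<close>
    have "0 \<le> s" "s \<le> ereal ?B"
      unfolding s_def using ge le by (auto intro: SUP_least SUP_upper2)
    then obtain c where c: "s = ereal c" "c \<le> ?B" by (cases s) auto
    show "F_threshold_exists p a"
      unfolding F_threshold_exists_def using conv c by blast
    show "F_threshold p a \<le> ?B"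
      unfolding F_threshold_def using limI[OF conv] c by simp
  }
  assume "ideal_val v vars_ideal > 0 \<and> F_threshold_exists p a"
  then obtain c where m: "ideal_val v vars_ideal > 0" and c: "nu_ratio p a \<longlonglongrightarrow> ereal c"
    unfolding F_threshold_exists_def by blast
  \<comment> \<open>Exceeding \<open>c\<close> puts the ratios eventually below \<open>C\<close>;
    \<open>C \<ge> 1\<close> makes \<open>r e\<close> below at least \<open>e\<close>.\<close>
  define C where "C = max (c + 1) 1"
  have C: "C \<ge> 1" "c < C" by (auto simp: C_def)
  \<comment> \<open>The least integer strictly above \<open>C * p ^ e\<close>: strictness forces
    \<open>a (r e)\<close> into the Frobenius power, minimality keeps \<open>r e\<close> linear in
    \<open>p ^ e\<close>.\<close>
  define r where "r e = Suc (nat \<lfloor>C * real (p ^ e)\<rfloor>)" for e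
  have r_gt: "C * real (p ^ e) < real (r e)" and r_le: "real (r e) \<le> C * real (p ^ e) + 1" for e
  proof -
    have "0 \<le> C * real (p ^ e)" using C by simp
    then have "real (r e) = of_int \<lfloor>C * real (p ^ e)\<rfloor> + 1" by (simp add: r_def)
    then show "C * real (p ^ e) < real (r e)" "real (r e) \<le> C * real (p ^ e) + 1" by linarith+
  qed
  have "filterlim r at_top sequentially"
  proof (rule filterlim_at_top_mono[OF filterlim_ident], intro always_eventually allI)
    fix e
    have "real e \<le> real (p ^ e)"
      using less_imp_le[OF power_gt_expt[of p e]] p0(2) by (simp only: of_nat_le_iff)
    also have "\<dots> \<le> C * real (p ^ e)"
      using mult_right_mono[OF C(1), of "real (p ^ e)"] by simp
    finally show "e \<le> r e" using r_gt[of e] by linarith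
  qed
  \<comment> \<open>Since the full limit is known to exist, a lower bound along these indices
    suffices.\<close>
  then have "(\<lambda>e. ideal_val v (a (r e)) / real (r e)) \<longlonglongrightarrow> ?w"
    using lim(1) by (rule filterlim_compose[rotated])
  moreover have "\<forall>\<^sub>F e in sequentially. ideal_val v vars_ideal / (C + 1) \<le> ideal_val v (a (r e)) / real (r e)"
  proof -
    have "\<forall>\<^sub>F e in sequentially. nu_ratio p a e < ereal C"
      using C order_tendstoD(2)[OF c] by simp
    then show ?thesis
    proof eventually_elim
      case (elim e)
      have q: "real (p ^ e) \<ge> 1" using p0 by simp
      have "a (r e) \<subseteq> frob_power (p ^ e)"
      proof (rule ccontr)
        assume "\<not> ?thesis"
        then have "real (r e) / real (p ^ e) \<le> C"
          using nu_ratio_le_iff[OF assms(3) p0(1), of e "ereal C"] elim by (auto simp: less_imp_le)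
        then show False using r_gt[of e] p0 by (simp add: field_simps)
      qed
      moreover obtain f where f: "f \<in> a (r e)" "f \<noteq> 0" "ideal_val v (a (r e)) = v (to_fract f)"
        using ideal_val_attained[OF nz[of "r e"]] by blast
      ultimately have "f \<in> frob_power (p ^ e)" by blast
      then have le: "real (p ^ e) * ideal_val v vars_ideal \<le> ideal_val v (a (r e))"
        unfolding f(3) using f(2) by (rule val_ge_if_in_frob_power)
      \<comment> \<open>As \<open>p ^ e \<ge> 1\<close>, the rounding error of 1 is absorbed by
        replacing \<open>C\<close> with \<open>C + 1\<close>.\<close>
      have "real (r e) * ideal_val v vars_ideal
                       \<le> ((C + 1) * real (p ^ e)) * ideal_val v vars_ideal"
        using r_le[of e] q m by (intro mult_right_mono) (auto simp: algebra_simps)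
      also have "\<dots> \<le> (C + 1) * ideal_val v (a (r e))"
        unfolding mult.assoc using le C by (intro mult_left_mono) auto
      finally have "real (r e) * ideal_val v vars_ideal \<le> (C + 1) * ideal_val v (a (r e))" .
      moreover have "real (r e) > 0" by (simp add: r_def)
      ultimately show ?case using C by (simp add: field_simps)
    qed
  qed
  ultimately have "ideal_val v vars_ideal / (C + 1) \<le> ?w"
    by (intro tendsto_lowerbound) auto
  moreover have "ideal_val v vars_ideal / (C + 1) > 0" using m C by simp
  ultimately show "?w > 0" by linarith
qed

end
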